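(* Consider a balanced generalized Pólya urn with replacement matrix $R=\begin{pmatrix} a & b \\ c & d \end{pmatrix}$, composition $U_n$ at time $n$, and $S=a+b=c+d$, $m=a-c=d-b$, $\sigma=m/S$, $v_1=\frac{S}{b+c}\begin{pmatrix} c \\ b \end{pmatrix}$. Assume that the urn is critically small, i.e. $\sigma=1/2$, and that $bc\neq0$. Then $$\frac{U_n-nv_1}{\sqrt{n\log n}}\;\xrightarrow[n\to\infty]{\mathcal{L}}\;\mathcal{N}(0,\Gamma),\qquad \Gamma=bc\begin{pmatrix} 1 & -1 \\ -1 & 1 \end{pmatrix},$$ where $\xrightarrow{\mathcal{L}}$ denotes convergence in distribution and $\mathcal{N}(0,\Gamma)$ is the (degenerate) centered Gaussian law on $\mathbb{R}^2$ with covariance matrix $\Gamma$.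
   Context: Generalized Pólya urn model: $a,b,c,d$ are nonnegative integers, the replacement matrix $R$ is not diagonal ($b+c\ge1$), and the urn is balanced: $a+b=c+d=S\ge1$. At time $0$ the urn contains $\alpha\ge0$ red balls and $\beta\ge0$ white balls ($\alpha,\beta$ integers), with $\tau=\alpha+\beta\ge1$. At each time $n\ge1$ one ball is drawn uniformly at random from the urn and its color observed. If it is red, it is returned together with $a$ additional red balls and $b$ additional white balls; if it is white, it is returned together with $c$ additional red balls and $d$ additional white balls. $U_n=(X_n,Y_n)^T$, where $X_n$ and $Y_n$ are the numbers of red and white balls at time $n$; $U_0=(\alpha,\beta)^T$ and $X_n+Y_n=\tau_n=\tau+nS$. Equivalently, $U_{n+1}=U_n+R^T(\varepsilon_{n+1},1-\varepsilon_{n+1})^T$, where the conditional distribution of $\varepsilon_{n+1}$ given the past $\mathcal{F}_n$ up to time $n$ is Bernoulli with parameter $X_n/\tau_n$. *)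

theory Defs
  imports "HOL-Probability.Probability"
begin

definition converges_in_distribution ::
    "'w measure \<Rightarrow> (nat \<Rightarrow> 'w \<Rightarrow> 'e::topological_space) \<Rightarrow> 'e measure \<Rightarrow> bool" where
  "converges_in_distribution M Z N \<longleftrightarrow>
     (\<forall>f :: 'e \<Rightarrow> real. continuous_on UNIV f \<and> bounded (range f) \<longrightarrow>
        (\<lambda>n. integral\<^sup>L (distr M borel (Z n)) f) \<longlonglongrightarrow> integral\<^sup>L N f)"

definition standard_gaussian :: "(real ^ 'n) measure" where
  "standard_gaussian =
     distr (Pi\<^sub>M UNIV (\<lambda>i::'n. density lborel std_normal_density)) borel (\<lambda>z. \<chi> i. z i)"

text \<open>
  The law of \<open>\<mu> + A Z\<close>, with \<open>Z\<close> standard Gaussian and \<open>A A\<^sup>T = \<Gamma>\<close>.  For \<open>\<Gamma>\<close> symmetric positive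
  semidefinite (possibly singular) such an \<open>A\<close> exists and the law does not depend on its choice.
\<close>
definition gaussian :: "real ^ 'n \<Rightarrow> real ^ 'n ^ 'n \<Rightarrow> (real ^ 'n) measure" where
  "gaussian \<mu> \<Gamma> =
     distr standard_gaussian borel
       (\<lambda>z. \<mu> + (SOME A :: real ^ 'n ^ 'n. A ** transpose A = \<Gamma>) *v z)"

definition past :: "'w measure \<Rightarrow> (nat \<Rightarrow> 'w \<Rightarrow> real) \<Rightarrow> nat \<Rightarrow> 'w measure" where
  "past M \<epsilon> n =
     sigma (space M) {\<epsilon> i -` B \<inter> space M | i B. i \<in> {1..n} \<and> B \<in> sets borel}"

definition replacement_matrix :: "nat \<Rightarrow> nat \<Rightarrow> nat \<Rightarrow> nat \<Rightarrow> real ^ 2 ^ 2" where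
  "replacement_matrix a b c d = vector [vector [real a, real b], vector [real c, real d]]"

text \<open>
  \<open>\<epsilon> n\<close> is 1 or 0 according to whether the \<open>n\<close>-th ball drawn (\<open>n \<ge> 1\<close>; \<open>\<epsilon> 0\<close> plays no role)
  is red or white; \<open>U n\<close> is the vector (number of red balls, number of white balls) at time \<open>n\<close>.
\<close>
locale balanced_polya_urn = prob_space M for M :: "'w measure" +
  fixes a b c d \<alpha> \<beta> :: nat
    and \<epsilon> :: "nat \<Rightarrow> 'w \<Rightarrow> real"
    and U :: "nat \<Rightarrow> 'w \<Rightarrow> real ^ 2"
  assumes not_diagonal: "b + c \<ge> 1"
    and balanced: "a + b = c + d"
    and balance_pos: "a + b \<ge> 1"
    and initial_nonempty: "\<alpha> + \<beta> \<ge> 1"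
    and draw_measurable: "\<And>n. \<epsilon> n \<in> borel_measurable M"
    and draw_values: "\<And>n w. w \<in> space M \<Longrightarrow> \<epsilon> n w \<in> {0, 1}"
    and initial: "\<And>w. w \<in> space M \<Longrightarrow> U 0 w = vector [real \<alpha>, real \<beta>]"
    and step: "\<And>n w. w \<in> space M \<Longrightarrow>
      U (Suc n) w = U n w +
        transpose (replacement_matrix a b c d) *v vector [\<epsilon> (Suc n) w, 1 - \<epsilon> (Suc n) w]"
    and draw_law: "\<And>n. AE w in M.
      real_cond_exp M (past M \<epsilon> n) (indicator {w \<in> space M. \<epsilon> (Suc n) w = 1}) w =
        U n w $ 1 / (real (\<alpha> + \<beta>) + real n * real (a + b))"

end

theory Submission
  imports Defs "HOL-Real_Asymp.Real_Asymp"
begin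

text \<open>
  Let \<open>W\<^sub>n = X\<^sub>n - (c / (b + c)) \<tau>\<^sub>n\<close> and \<open>Z\<^sub>n = W\<^sub>n / sqrt \<tau>\<^sub>n\<close>.  At criticality \<open>Z\<close> is a martingale up to a
  factor \<open>1 + O(1 / n\<^sup>2)\<close> in each step, with increments of size \<open>O(1 / sqrt n)\<close> and conditional variance
  \<open>m\<^sup>2 p\<^sub>n (1 - p\<^sub>n) / \<tau>\<^sub>n\<^sub>+\<^sub>1\<close>, where \<open>p\<^sub>n = X\<^sub>n / \<tau>\<^sub>n\<close>.  As \<open>p\<^sub>n - c / (b + c) = Z\<^sub>n / sqrt \<tau>\<^sub>n\<close> and
  \<open>E Z\<^sub>n\<^sup>2 = O(ln n)\<close>, this variance may be replaced by \<open>b c / \<tau>\<^sub>n\<^sub>+\<^sub>1\<close>, and the characteristic function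
  of \<open>Z\<^sub>n\<close> at \<open>\<theta>\<close> picks up the factor \<open>exp (- \<theta>\<^sup>2 b c / (2 \<tau>\<^sub>n\<^sub>+\<^sub>1))\<close> at each step, with errors that are
  summable and at most proportional to \<open>\<bar>\<theta>\<bar>\<close>.  Rescaling by \<open>sqrt (ln n)\<close> lets \<open>\<theta>\<close> tend to \<open>0\<close> while the
  exponent, a harmonic sum, converges.  The composition vector is \<open>(W\<^sub>n, - W\<^sub>n)\<close> up to a deterministic
  bounded shift, which Skorohod's representation absorbs.
\<close>

section \<open>Gaussian laws on the antidiagonal\<close>

lemma vec_lambda_measurable [measurable]:
  "(\<lambda>z::'n::finite \<Rightarrow> real. \<chi> i. z i) \<in> borel_measurable (Pi\<^sub>M UNIV (\<lambda>i. density lborel std_normal_density))"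
  unfolding borel_measurable_euclidean_space[of "\<lambda>z. \<chi> i. z i"]
  by (auto simp: Basis_vec_def inner_axis)

lemma prob_space_standard_gaussian: "prob_space (standard_gaussian :: (real ^ 'n) measure)"
proof -
  interpret product_prob_space "\<lambda>i::'n. density lborel std_normal_density" UNIV
    using real_dist_normal_dist
    by (intro product_prob_spaceI) (auto simp: real_distribution_def)
  show ?thesis
    unfolding standard_gaussian_def by (intro prob_space_distr) measurable
qed

lemma sets_standard_gaussian [measurable_cong, simp]: "sets standard_gaussian = sets borel"
  by (simp add: standard_gaussian_def)

text \<open>The product measure splits the characteristic function into one-dimensional ones at
  \<open>t * r $ i\<close>, whose exponents add up to the squared norm of \<open>r\<close>. Using
  characteristic functions instead of densities also covers the degenerate case
  \<open>r = 0\<close>.\<close>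

lemma char_inner_standard_gaussian:
  fixes r :: "real ^ 'n"
  shows "char (distr standard_gaussian borel (\<lambda>z. r \<bullet> z)) t = complex_of_real (exp (- (t\<^sup>2 * (norm r)\<^sup>2) / 2))"
proof -
  interpret N: real_distribution std_normal_distribution by (rule real_dist_normal_dist)
  interpret product_prob_space "\<lambda>i::'n. density lborel std_normal_density" UNIV
    by (intro product_prob_spaceI N.prob_space_axioms)
  have "char (distr standard_gaussian borel (\<lambda>z. r \<bullet> z)) t
      = (CLINT z|Pi\<^sub>M UNIV (\<lambda>i::'n. density lborel std_normal_density). iexp (t * (r \<bullet> (\<chi> i. z i))))"
    unfolding char_def standard_gaussian_def by (simp add: distr_distr comp_def integral_distr)
  also have "\<dots> = (CLINT z|Pi\<^sub>M UNIV (\<lambda>i::'n. density lborel std_normal_density).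
      (\<Prod>i\<in>UNIV. iexp (t * r $ i * z i)))"
    by (simp add: inner_vec_def exp_sum[symmetric] sum_distrib_left mult_ac)
  also have "\<dots> = (\<Prod>i\<in>UNIV. CLINT x|std_normal_distribution. iexp (t * r $ i * x))"
    by (intro product_integral_prod) (auto intro!: N.integrable_iexp simp del: of_real_mult)
  also have "\<dots> = (\<Prod>i\<in>UNIV. char std_normal_distribution (t * r $ i))"
    by (simp add: char_def mult_ac)
  also have "\<dots> = (\<Prod>i\<in>UNIV. exp (complex_of_real (- ((t * r $ i)\<^sup>2) / 2)))"
    by (simp add: char_std_normal_distribution exp_of_real del: of_real_divide of_real_minus)
  also have "\<dots> = exp (complex_of_real (\<Sum>i\<in>UNIV. - ((t * r $ i)\<^sup>2) / 2))"
    by (simp add: exp_sum)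
  also have "(\<Sum>i\<in>UNIV. - ((t * r $ i)\<^sup>2) / 2) = - (t\<^sup>2 * (norm r)\<^sup>2) / 2"
    by (simp add: norm_vec_def L2_set_def sum_nonneg power_mult_distrib sum_distrib_left
        sum_negf sum_divide_distrib)
  finally show ?thesis by (simp only: exp_of_real)
qed

lemma vector_antidiagonal_measurable [measurable]:
  "(\<lambda>x::real. vector [x, - x] :: real ^ 2) \<in> borel_measurable borel"
  unfolding borel_measurable_euclidean_space[of "\<lambda>x. vector [x, - x]"]
  by (auto simp: Basis_vec_def inner_axis UNIV_2)

text \<open>\<open>gaussian\<close> uses a square root picked by \<open>SOME\<close>, of which only
  \<open>A ** transpose A\<close> is known. The entries of that product are the inner products of
  the rows of \<open>A\<close>; they force the second row to be the negative of the first, so every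
  choice gives the image of a one-dimensional Gaussian law.\<close>

lemma gaussian_antidiagonal:
  fixes v :: real
  assumes "0 \<le> v"
  obtains r :: "real ^ 2" where "(norm r)\<^sup>2 = v"
    "gaussian 0 (v *\<^sub>R vector [vector [1, - 1], vector [- 1, 1]])
      = distr (distr standard_gaussian borel (\<lambda>z. r \<bullet> z)) borel (\<lambda>x. vector [x, - x] :: real ^ 2)"
proof -
  let ?G = "v *\<^sub>R vector [vector [1, - 1], vector [- 1, 1]] :: real ^ 2 ^ 2"
  define A where "A = (SOME A :: real ^ 2 ^ 2. A ** transpose A = ?G)"
  \<comment> \<open>An explicit square root shows that the choice is not vacuous.\<close>
  have "(sqrt v *\<^sub>R vector [vector [1, 0], vector [- 1, 0]] :: real ^ 2 ^ 2)
      ** transpose (sqrt v *\<^sub>R vector [vector [1, 0], vector [- 1, 0]]) = ?G"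
    using assms by (simp add: vec_eq_iff matrix_matrix_mult_def transpose_def forall_2 sum_2)
  then have A: "A ** transpose A = ?G"
    unfolding A_def by (rule someI)
  have entry: "A $ i \<bullet> A $ j = ?G $ i $ j" for i j
    unfolding A[symmetric]
    by (simp add: matrix_matrix_mult_def transpose_def inner_vec_def)
  \<comment> \<open>The squared norm of the sum of the rows is the sum of the four entries of
    \<open>?G\<close>, which is zero.\<close>
  have "(A $ 1 + A $ 2) \<bullet> (A $ 1 + A $ 2) = 0"
    by (simp add: inner_add_left inner_add_right entry)
  then have "A $ 2 = - (A $ 1)"
    by (simp add: add_eq_0_iff)
  then have "A $ 2 \<bullet> z = - (A $ 1 \<bullet> z)" for z
    by simp
  then have Az: "A *v z = vector [A $ 1 \<bullet> z, - (A $ 1 \<bullet> z)]" for z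
    by (simp add: vec_eq_iff forall_2 matrix_vector_mul_component)
  show ?thesis
  proof (rule that)
    show "(norm (A $ 1))\<^sup>2 = v"
      using entry[of 1 1] by (simp add: power2_norm_eq_inner)
    show "gaussian 0 ?G
      = distr (distr standard_gaussian borel (\<lambda>z. A $ 1 \<bullet> z)) borel (\<lambda>x. vector [x, - x])"
      unfolding gaussian_def A_def[symmetric] Az
      by (subst distr_distr[OF vector_antidiagonal_measurable]) (simp_all add: comp_def)
  qed
qed

text \<open>As \<open>f\<close> need not be uniformly continuous, the shift cannot be removed by a
  modulus of continuity. Skorohod's representation makes the convergence pointwise, so continuity of
  \<open>f\<close> at the limit point handles the shift too, and boundedness of \<open>f\<close>
  gives dominated convergence.\<close>

lemma weak_conv_antidiagonal_shift:
  fixes \<mu> :: "nat \<Rightarrow> real measure" and f :: "real ^ 2 \<Rightarrow> real" and s :: "nat \<Rightarrow> real ^ 2"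
  assumes \<mu>: "\<And>n. real_distribution (\<mu> n)" and \<nu>: "real_distribution \<nu>" and conv: "weak_conv_m \<mu> \<nu>"
    and f: "continuous_on UNIV f" "bounded (range f)" and s: "s \<longlonglongrightarrow> 0"
  shows "(\<lambda>n. LINT x|\<mu> n. f (vector [x, - x] + s n)) \<longlonglongrightarrow> (LINT x|\<nu>. f (vector [x, - x]))"
proof -
  from Skorohod[OF \<mu> \<nu> conv] obtain \<Omega> :: "real measure" and Y :: "nat \<Rightarrow> real \<Rightarrow> real" and Y' where
    \<Omega>: "prob_space \<Omega>" and Y[measurable]: "\<And>n. Y n \<in> borel_measurable \<Omega>" and Y': "Y' \<in> measurable \<Omega> lborel"
    and dist: "\<And>n. distr \<Omega> borel (Y n) = \<mu> n" "distr \<Omega> borel Y' = \<nu>"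
    and lim: "\<And>x. x \<in> space \<Omega> \<Longrightarrow> (\<lambda>n. Y n x) \<longlonglongrightarrow> Y' x"
    by blast
  interpret prob_space \<Omega> by (rule \<Omega>)
  have [measurable]: "Y' \<in> borel_measurable \<Omega>" using Y' by simp
  have [measurable]: "f \<in> borel_measurable borel"
    using f(1) by (rule borel_measurable_continuous_onI)
  obtain B where B: "\<And>x. norm (f x) \<le> B"
    using f(2) by (auto simp: bounded_iff)
  have "(\<lambda>n. LINT x|\<Omega>. f (vector [Y n x, - Y n x] + s n)) \<longlonglongrightarrow> (LINT x|\<Omega>. f (vector [Y' x, - Y' x]))"
  proof (rule integral_dominated_convergence[where w = "\<lambda>_. B"])
    show "AE x in \<Omega>. (\<lambda>n. f (vector [Y n x, - Y n x] + s n)) \<longlonglongrightarrow> f (vector [Y' x, - Y' x])"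
    proof (intro AE_I2)
      fix x assume x: "x \<in> space \<Omega>"
      have "(\<lambda>n. vector [Y n x, - Y n x] + s n) \<longlonglongrightarrow> vector [Y' x, - Y' x] + 0"
      proof (intro tendsto_add s vec_tendstoI)
        show "(\<lambda>n. (vector [Y n x, - Y n x] :: real ^ 2) $ i) \<longlonglongrightarrow> vector [Y' x, - Y' x] $ i" for i
          using exhaust_2[of i] lim[OF x] by (auto intro: tendsto_minus)
      qed
      moreover have "isCont f (vector [Y' x, - Y' x])"
        using f(1) by (simp add: continuous_on_eq_continuous_at)
      ultimately show "(\<lambda>n. f (vector [Y n x, - Y n x] + s n)) \<longlonglongrightarrow> f (vector [Y' x, - Y' x])"
        using isCont_tendsto_compose by force
    qed
  qed (use B in auto)
  then show ?thesis
    by (simp add: dist[symmetric] integral_distr)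
qed

section \<open>Estimates for characteristic functions\<close>

text \<open>Averaging with weights \<open>p\<close> and \<open>1 - p\<close> cancels the linear
  Taylor terms and turns the quadratic ones into the variance. Both arguments are at most
  \<bar>s\<bar> in modulus, which bounds the averaged cubic remainders; the factor 1/6 is given
  away.\<close>

lemma centered_bernoulli_char_approx:
  fixes p s :: real
  assumes p: "0 \<le> p" "p \<le> 1"
  shows "cmod (p * iexp (s * (1 - p)) + (1 - p) * iexp (- (s * p)) - (1 - s\<^sup>2 * (p * (1 - p)) / 2)) \<le> \<bar>s\<bar> ^ 3"
proof -
  define R where "R x = iexp x - (\<Sum>k\<le>2. (\<i> * x) ^ k / fact k)" for x :: real
  have R: "cmod (R x) \<le> \<bar>x\<bar> ^ 3 / 6" for x
    using iexp_approx1[of x 2] by (simp add: R_def eval_nat_numeral)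
  have Rb: "cmod (R x) \<le> \<bar>s\<bar> ^ 3" if "\<bar>x\<bar> \<le> \<bar>s\<bar>" for x
  proof -
    have "\<bar>x\<bar> ^ 3 \<le> \<bar>s\<bar> ^ 3" using that by (intro power_mono) auto
    then show ?thesis using R[of x] zero_le_power[of "\<bar>x\<bar>" 3] by linarith
  qed
  have iexp: "iexp x = 1 + \<i> * x - x\<^sup>2 / 2 + R x" for x
    by (simp add: R_def numeral_2_eq_2 power_mult_distrib)
  define P Q where "P = R (s * (1 - p))" and "Q = R (- (s * p))"
  have iexp_PQ: "iexp (s * (1 - p)) = 1 + \<i> * (s * (1 - p)) - (s * (1 - p))\<^sup>2 / 2 + P"
    "iexp (- (s * p)) = 1 + \<i> * (- (s * p)) - (- (s * p))\<^sup>2 / 2 + Q"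
    unfolding P_def Q_def using iexp[of "s * (1 - p)"] iexp[of "- (s * p)"] by simp_all
  have "p * iexp (s * (1 - p)) + (1 - p) * iexp (- (s * p)) - (1 - s\<^sup>2 * (p * (1 - p)) / 2)
      = p * P + (1 - p) * Q"
    unfolding iexp_PQ
    unfolding of_real_mult of_real_diff of_real_minus of_real_1 of_real_divide of_real_power of_real_numeral
    by (simp add: field_simps power2_eq_square)
  also have "cmod \<dots> \<le> p * \<bar>s\<bar> ^ 3 + (1 - p) * \<bar>s\<bar> ^ 3"
  proof (rule order.trans[OF norm_triangle_ineq], rule add_mono)
    have "\<bar>s * (1 - p)\<bar> \<le> \<bar>s\<bar>" "\<bar>- (s * p)\<bar> \<le> \<bar>s\<bar>"
      using p by (auto simp: abs_mult intro!: mult_left_le)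
    note Rb = this[THEN Rb]
    show "cmod (p * P) \<le> p * \<bar>s\<bar> ^ 3"
      using Rb(1) p by (simp add: P_def norm_mult mult_left_mono)
    have "cmod ((1 - p) * Q) = (1 - p) * cmod Q"
      using p norm_of_real[of "1 - p", where 'a = complex] by (simp add: norm_mult)
    also have "\<dots> \<le> (1 - p) * \<bar>s\<bar> ^ 3" using Rb(2) p unfolding Q_def by (intro mult_left_mono) auto
    finally show "cmod ((1 - p) * Q) \<le> (1 - p) * \<bar>s\<bar> ^ 3" .
  qed
  finally show ?thesis by (simp flip: distrib_right)
qed

lemma iexp_lipschitz: "cmod (iexp x - iexp y) \<le> \<bar>x - y\<bar>"
proof -
  have "iexp x - iexp y = iexp y * (iexp (x - y) - 1)"
    by (simp only: right_diff_distrib exp_add[symmetric]) (simp add: algebra_simps)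
  then show ?thesis
    using iexp_approx1[of "x - y" 0] by (simp add: norm_mult)
qed

lemma exp_minus_approx:
  fixes y :: real
  assumes "0 \<le> y"
  shows "\<bar>exp (- y) - (1 - y)\<bar> \<le> y\<^sup>2"
proof -
  have "1 - y \<le> exp (- y)" using exp_ge_add_one_self[of "- y"] by simp
  moreover have "exp (- y) \<le> 1 - y + y\<^sup>2"
  proof -
    have "exp (- y) * (1 + y) \<le> exp (- y) * exp y"
      by (intro mult_left_mono) auto
    then have "exp (- y) * (1 + y) \<le> 1" by (simp add: exp_minus)
    \<comment> \<open>The right-hand side is \<open>1 + y ^ 3\<close>.\<close>
    moreover have "1 \<le> (1 - y + y\<^sup>2) * (1 + y)"
      using assms by (simp add: algebra_simps power2_eq_square)
    ultimately have "exp (- y) * (1 + y) \<le> (1 - y + y\<^sup>2) * (1 + y)"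
      by (rule order.trans)
    then show ?thesis
      using assms by (rule_tac mult_right_le_imp_le[of _ "1 + y"]) auto
  qed
  ultimately show ?thesis by simp
qed

text \<open>The factors \<open>exp (- y k)\<close> are at most 1, so an error made at one step is
  not amplified by later ones and the errors simply add up.\<close>

lemma approximate_product:
  fixes f :: "nat \<Rightarrow> complex" and y err :: "nat \<Rightarrow> real"
  assumes step: "\<And>k. cmod (f (Suc k) - exp (- y k) * f k) \<le> err k" and y: "\<And>k. 0 \<le> y k"
  shows "cmod (f n - exp (- (\<Sum>k<n. y k)) * f 0) \<le> (\<Sum>k<n. err k)"
proof (induction n)
  case (Suc n)
  let ?e = "complex_of_real (exp (- y n))" and ?E = "complex_of_real (exp (- (\<Sum>k<n. y k)))"
  have E: "complex_of_real (exp (- (\<Sum>k<Suc n. y k))) = ?e * ?E"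
    by (simp add: mult_exp_exp add.commute del: of_real_exp flip: of_real_mult)
  have "f (Suc n) - complex_of_real (exp (- (\<Sum>k<Suc n. y k))) * f 0 = (f (Suc n) - ?e * f n) + ?e * (f n - ?E * f 0)"
    unfolding E by (simp add: algebra_simps)
  also have "cmod \<dots> \<le> err n + 1 * (\<Sum>k<n. err k)"
  proof (rule order.trans[OF norm_triangle_ineq], rule add_mono)
    show "cmod (f (Suc n) - ?e * f n) \<le> err n" by (rule step)
    have "cmod ?e \<le> 1" unfolding norm_of_real using y[of n] by simp
    then show "cmod (?e * (f n - ?E * f 0)) \<le> 1 * (\<Sum>k<n. err k)"
      unfolding norm_mult using Suc by (intro mult_mono) auto
  qed
  finally show ?case by simp
qed simp

text \<open>The four error terms come, in order, from replacing the factor \<open>\<rho>\<close> by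
  1 (Lipschitz bound), from the cubic Taylor remainder of \<open>G\<close>, from replacing the
  conditional variance by the target exponent \<open>y\<close>, and from linearising
  \<open>exp (- y)\<close>.\<close>

lemma centered_bernoulli_step:
  fixes p \<theta> \<rho> s y z :: real
  assumes p: "0 \<le> p" "p \<le> 1" and y: "0 \<le> y"
  defines "G \<equiv> p * iexp (s * (1 - p)) + (1 - p) * iexp (- (s * p))"
  shows "cmod (iexp (\<theta> * \<rho> * z) * G - exp (- y) * iexp (\<theta> * z))
    \<le> \<bar>\<theta>\<bar> * \<bar>\<rho> - 1\<bar> * \<bar>z\<bar> + \<bar>s\<bar> ^ 3 + \<bar>s\<^sup>2 * (p * (1 - p)) / 2 - y\<bar> + y\<^sup>2"
proof -
  let ?v = "s\<^sup>2 * (p * (1 - p)) / 2"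
  have "iexp (\<theta> * \<rho> * z) * G - exp (- y) * iexp (\<theta> * z)
      = (iexp (\<theta> * \<rho> * z) - iexp (\<theta> * z)) * G
        + iexp (\<theta> * z) * ((G - (1 - ?v)) + (complex_of_real (y - ?v) + complex_of_real (1 - y - exp (- y))))"
    by (simp add: algebra_simps)
  moreover have "cmod ((iexp (\<theta> * \<rho> * z) - iexp (\<theta> * z)) * G) \<le> (\<bar>\<theta>\<bar> * \<bar>\<rho> - 1\<bar> * \<bar>z\<bar>) * 1"
    unfolding norm_mult
  proof (rule mult_mono)
    have "\<bar>\<theta> * \<rho> * z - \<theta> * z\<bar> = \<bar>\<theta>\<bar> * \<bar>\<rho> - 1\<bar> * \<bar>z\<bar>"
      by (simp add: abs_mult[symmetric] algebra_simps)
    then show "cmod (iexp (\<theta> * \<rho> * z) - iexp (\<theta> * z)) \<le> \<bar>\<theta>\<bar> * \<bar>\<rho> - 1\<bar> * \<bar>z\<bar>"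
      using iexp_lipschitz[of "\<theta> * \<rho> * z" "\<theta> * z"] by simp
    have "cmod G \<le> cmod (p * iexp (s * (1 - p))) + cmod ((1 - p) * iexp (- (s * p)))"
      unfolding G_def by (rule norm_triangle_ineq)
    also have "\<dots> = p + (1 - p)"
      using p norm_of_real[of "1 - p", where 'a = complex]
      by (simp add: norm_mult del: of_real_mult of_real_minus)
    finally show "cmod G \<le> 1" by simp
  qed auto
  moreover have "cmod (iexp (\<theta> * z) * ((G - (1 - ?v)) + (complex_of_real (y - ?v) + complex_of_real (1 - y - exp (- y)))))
      \<le> \<bar>s\<bar> ^ 3 + (\<bar>?v - y\<bar> + y\<^sup>2)"
  proof -
    have "cmod (G - (1 - ?v)) \<le> \<bar>s\<bar> ^ 3"
      using centered_bernoulli_char_approx[OF p, of s] by (simp add: G_def)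
    moreover have "cmod (complex_of_real (y - ?v)) = \<bar>?v - y\<bar>"
      unfolding norm_of_real by simp
    moreover have "cmod (complex_of_real (1 - y - exp (- y))) \<le> y\<^sup>2"
      unfolding norm_of_real using exp_minus_approx[OF y] by simp
    ultimately have "cmod ((G - (1 - ?v)) + (complex_of_real (y - ?v) + complex_of_real (1 - y - exp (- y))))
        \<le> \<bar>s\<bar> ^ 3 + (\<bar>?v - y\<bar> + y\<^sup>2)"
      by (intro order.trans[OF norm_triangle_ineq] add_mono) auto
    then show ?thesis
      by (simp add: norm_mult del: of_real_mult)
  qed
  ultimately show ?thesis
    by (smt (verit, ccfv_SIG) norm_triangle_ineq)
qed

text \<open>The exponent 5/4 lies strictly between 1 and 3/2: this leaves room to absorb the
  logarithm and still gives a convergent series.\<close>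

lemma summable_ln_div_linear:
  fixes t m A B :: real
  assumes t: "0 < t" and m: "0 < m"
  shows "summable (\<lambda>k. (A + B * ln (t + real k * m)) / ((t + real k * m) * sqrt (t + real k * m)))"
proof -
  have *: "summable (\<lambda>k. norm (real k powr (-5/4)))"
    by (simp add: summable_real_powr_iff)
  have 1: "(\<lambda>k. 1 / ((t + real k * m) * sqrt (t + real k * m))) \<in> O(\<lambda>k. real k powr (-5/4))"
    using t m by real_asymp
  have 2: "(\<lambda>k. ln (t + real k * m) / ((t + real k * m) * sqrt (t + real k * m))) \<in> O(\<lambda>k. real k powr (-5/4))"
    using t m by real_asymp
  note S = summable_comparison_test_bigo[OF * 1] summable_comparison_test_bigo[OF * 2]
  have "summable (\<lambda>k. A * (1 / ((t + real k * m) * sqrt (t + real k * m)))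
      + B * (ln (t + real k * m) / ((t + real k * m) * sqrt (t + real k * m))))"
    by (rule summable_add[OF summable_mult[OF S(1)] summable_mult[OF S(2)]])
  then show ?thesis
    by (simp add: add_divide_distrib)
qed

section \<open>The critical urn\<close>

text \<open>This is \<open>\<sigma> = 1 / 2\<close>, that is \<open>2 * (a - c) = a + b\<close>,
  written without subtraction on natural numbers.\<close>

locale critical_polya_urn = balanced_polya_urn +
  assumes critical: "a = b + 2 * c"
begin

text \<open>At criticality \<open>b + c\<close> is both \<open>S / 2\<close> and \<open>m = a - c\<close>.\<close>
definition half_balance :: real where "half_balance = real b + real c"

definition total :: "nat \<Rightarrow> real" where "total n = real (\<alpha> + \<beta>) + real n * (2 * half_balance)"

definition red :: "nat \<Rightarrow> 'a \<Rightarrow> real" where "red n w = U n w $ 1"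

definition red_prob :: "nat \<Rightarrow> 'a \<Rightarrow> real" where "red_prob n w = red n w / total n"

text \<open>
  Dividing by \<open>sqrt (total n)\<close> instead of the product \<open>\<Prod>k<n. 1 + half_balance / total k\<close>
  gives only an approximate martingale, but the defect is summable and its recursion is explicit.
\<close>
definition dev :: "nat \<Rightarrow> 'a \<Rightarrow> real" where
  "dev n w = (red n w - real c / half_balance * total n) / sqrt (total n)"

lemma half_balance_ge_1: "1 \<le> half_balance"
  using not_diagonal by (simp add: half_balance_def)

lemma balance_eq: "real (a + b) = 2 * half_balance"
  by (simp add: half_balance_def critical)

lemma total_ge_1: "1 \<le> total n"
  using initial_nonempty half_balance_ge_1 by (simp add: total_def add_increasing2)

lemma total_Suc: "total (Suc n) = total n + 2 * half_balance"
  by (simp add: total_def algebra_simps)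

lemma total_pos [simp]: "0 < total n" "0 \<le> total n" "total n \<noteq> 0"
  using total_ge_1[of n] by auto

lemma half_balance_pos [simp]: "0 < half_balance" "0 \<le> half_balance" "half_balance \<noteq> 0"
  using half_balance_ge_1 by auto

lemma total_le_Suc: "total n \<le> total (Suc n)"
  by (simp add: total_Suc)

lemma draw_bounds: "w \<in> space M \<Longrightarrow> 0 \<le> \<epsilon> n w" "w \<in> space M \<Longrightarrow> \<epsilon> n w \<le> 1"
  using draw_values[of w n] by auto

lemma red_0: "w \<in> space M \<Longrightarrow> red 0 w = real \<alpha>"
  by (simp add: red_def initial)

text \<open>A white draw adds \<open>c\<close> red balls and a red draw adds \<open>a\<close>; by
  criticality \<open>a - c\<close> is \<open>half_balance\<close>.\<close>

lemma red_Suc: "w \<in> space M \<Longrightarrow> red (Suc n) w = red n w + real c + half_balance * \<epsilon> (Suc n) w"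
  by (simp add: red_def step matrix_vector_mult_def transpose_def replacement_matrix_def sum_2
      critical half_balance_def algebra_simps)

lemma white_eq: "w \<in> space M \<Longrightarrow> U n w $ 2 = total n - red n w"
proof (induction n)
  case 0
  then show ?case by (simp add: red_0 total_def initial)
next
  case (Suc n)
  have "c + real d = a + real b" using balanced by linarith
  then have d: "real d = 2 * b + c" by (simp add: critical)
  show ?case
    using Suc by (simp add: red_Suc total_Suc step matrix_vector_mult_def transpose_def
        replacement_matrix_def sum_2 d half_balance_def algebra_simps)
qed

lemma red_bounds:
  assumes w: "w \<in> space M"
  shows "0 \<le> red n w" "red n w \<le> total n"
proof (induction n)
  case 0
  show "0 \<le> red 0 w" "red 0 w \<le> total 0" using w by (simp_all add: red_0 total_def)
next
  case (Suc n)
  have "half_balance * \<epsilon> (Suc n) w \<le> half_balance * 1" "0 \<le> half_balance * \<epsilon> (Suc n) w"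
    using draw_bounds[OF w, of "Suc n"] by (auto intro: mult_left_mono)
  then show "0 \<le> red (Suc n) w" "red (Suc n) w \<le> total (Suc n)"
    using Suc w by (simp_all add: red_Suc total_Suc half_balance_def)
qed

lemma red_prob_bounds: "w \<in> space M \<Longrightarrow> 0 \<le> red_prob n w" "w \<in> space M \<Longrightarrow> red_prob n w \<le> 1"
  using red_bounds[of w n] by (auto simp: red_prob_def)

section \<open>The filtration and the conditional law of a draw\<close>

lemma space_past [simp]: "space (past M \<epsilon> n) = space M"
  by (simp add: past_def space_measure_of_conv)

lemma sets_past: "sets (past M \<epsilon> n) =
    sigma_sets (space M) {\<epsilon> i -` B \<inter> space M | i B. i \<in> {1..n} \<and> B \<in> sets borel}"
  unfolding past_def by (rule sets_measure_of) auto

lemma subalgebra_past: "subalgebra M (past M \<epsilon> n)"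
  unfolding subalgebra_def sets_past
  by (auto intro!: sets.sigma_sets_subset simp: measurable_sets[OF draw_measurable])

lemma draw_measurable_past: "i \<in> {1..n} \<Longrightarrow> \<epsilon> i \<in> borel_measurable (past M \<epsilon> n)"
  by (rule measurableI) (auto simp: sets_past intro!: sigma_sets.Basic)

lemma red_measurable_past [measurable]: "red n \<in> borel_measurable (past M \<epsilon> n)"
proof -
  have "red n w = real \<alpha> + real n * real c + half_balance * (\<Sum>i=1..n. \<epsilon> i w)" if "w \<in> space M" for w
    by (induction n) (simp_all add: red_0 red_Suc that algebra_simps)
  moreover have "(\<lambda>w. real \<alpha> + real n * real c + half_balance * (\<Sum>i=1..n. \<epsilon> i w))
      \<in> borel_measurable (past M \<epsilon> n)"
    by (intro borel_measurable_add borel_measurable_times borel_measurable_sum borel_measurable_const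
        draw_measurable_past)
  ultimately show ?thesis
    by (subst measurable_cong) auto
qed

lemma red_prob_measurable_past [measurable]: "red_prob n \<in> borel_measurable (past M \<epsilon> n)"
  unfolding red_prob_def by measurable

lemma dev_measurable_past [measurable]: "dev n \<in> borel_measurable (past M \<epsilon> n)"
  unfolding dev_def by measurable

lemmas past_measurable = measurable_from_subalg[OF subalgebra_past]

lemma red_measurable [measurable]: "red n \<in> borel_measurable M"
  and red_prob_measurable [measurable]: "red_prob n \<in> borel_measurable M"
  and dev_measurable [measurable]: "dev n \<in> borel_measurable M"
  by (rule past_measurable, measurable)+

declare draw_measurable [measurable]

text \<open>The defining property of conditional expectation, tested against \<open>h\<close>. This
  is where \<open>draw_law\<close> enters; it speaks of an indicator, which agrees with the draw
  because the draw is 0 or 1.\<close>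

lemma expectation_draw_real:
  fixes h :: "'a \<Rightarrow> real"
  assumes h: "h \<in> borel_measurable (past M \<epsilon> n)" and int: "integrable M h"
  shows "expectation (\<lambda>w. h w * \<epsilon> (Suc n) w) = expectation (\<lambda>w. h w * red_prob n w)"
proof -
  interpret finite_measure_subalgebra M "past M \<epsilon> n"
    by unfold_locales (rule subalgebra_past)
  let ?g = "indicator {w \<in> space M. \<epsilon> (Suc n) w = 1} :: 'a \<Rightarrow> real"
  have [measurable]: "h \<in> borel_measurable M"
    using int by simp
  have "{w \<in> space M. \<epsilon> (Suc n) w = 1} \<in> sets M"
    by measurable
  then have g [measurable]: "?g \<in> borel_measurable M"
    by simp
  have g_eq: "?g w = \<epsilon> (Suc n) w" if "w \<in> space M" for w
    using draw_values[OF that, of "Suc n"] that by (auto simp: indicator_def)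
  have "expectation (\<lambda>w. h w * \<epsilon> (Suc n) w) = expectation (\<lambda>w. h w * ?g w)"
    by (intro Bochner_Integration.integral_cong) (auto simp: g_eq)
  also have "\<dots> = expectation (\<lambda>w. h w * real_cond_exp M (past M \<epsilon> n) ?g w)"
  proof (rule real_cond_exp_intg(2)[symmetric])
    show "integrable M (\<lambda>w. h w * ?g w)"
      by (rule Bochner_Integration.integrable_bound[OF int]) (auto simp: indicator_def)
  qed (use h g in auto)
  also have "\<dots> = expectation (\<lambda>w. h w * red_prob n w)"
  proof (rule integral_cong_AE)
    show "AE w in M. h w * real_cond_exp M (past M \<epsilon> n) ?g w = h w * red_prob n w"
      using draw_law[of n]
      by eventually_elim (simp add: red_prob_def red_def total_def balance_eq[symmetric])
  qed measurable
  finally show ?thesis .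
qed

text \<open>The real version applies to the real and imaginary parts of \<open>h\<close>
  separately.\<close>

lemma expectation_draw_complex:
  fixes h :: "'a \<Rightarrow> complex"
  assumes h [measurable]: "h \<in> borel_measurable (past M \<epsilon> n)" and int: "integrable M h"
  shows "expectation (\<lambda>w. h w * \<epsilon> (Suc n) w) = expectation (\<lambda>w. h w * red_prob n w)"
proof -
  have [measurable]: "h \<in> borel_measurable M"
    using int by simp
  have int_h: "integrable M (\<lambda>w. h w * complex_of_real (g w))"
    if "g \<in> borel_measurable M" "\<And>w. w \<in> space M \<Longrightarrow> \<bar>g w\<bar> \<le> 1" for g
    using that by (intro Bochner_Integration.integrable_bound[OF int])
      (auto simp: norm_mult intro!: mult_left_le)
  have "\<bar>\<epsilon> (Suc n) w\<bar> \<le> 1" "\<bar>red_prob n w\<bar> \<le> 1" if "w \<in> space M" for w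
    using draw_bounds[OF that, of "Suc n"] red_prob_bounds[OF that, of n] by auto
  then have *: "integrable M (\<lambda>w. h w * \<epsilon> (Suc n) w)" "integrable M (\<lambda>w. h w * red_prob n w)"
    by (auto intro!: int_h)
  have "(\<lambda>w. Re (h w)) \<in> borel_measurable (past M \<epsilon> n)" "(\<lambda>w. Im (h w)) \<in> borel_measurable (past M \<epsilon> n)"
    by measurable
  note eq = this[THEN expectation_draw_real]
  show ?thesis
    using eq(1)[OF integrable_Re[OF int]] eq(2)[OF integrable_Im[OF int]]
      integral_Re[OF *(1)] integral_Re[OF *(2)] integral_Im[OF *(1)] integral_Im[OF *(2)]
    by (simp add: complex_eq_iff)
qed

section \<open>The recursion for the normalised deviation\<close>

definition growth :: "nat \<Rightarrow> real" where
  "growth n = (1 + half_balance / total n) * sqrt (total n / total (Suc n))"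

definition jump :: "nat \<Rightarrow> real" where "jump n = half_balance / sqrt (total (Suc n))"

text \<open>Criticality makes \<open>total\<close> grow by exactly \<open>2 * half_balance\<close>,
  so \<open>(total n + half_balance)\<^sup>2\<close> and \<open>total n * total (Suc n)\<close>
  differ only by a constant. The first-order terms cancel and the defect is of order 1/n^2.\<close>

lemma growth_square: "(growth n)\<^sup>2 = 1 + half_balance\<^sup>2 / (total n * total (Suc n))"
proof -
  have "(growth n)\<^sup>2 = (1 + half_balance / total n)\<^sup>2 * (total n / total (Suc n))"
    unfolding growth_def power_mult_distrib by simp
  also have "\<dots> = (total n + half_balance)\<^sup>2 / (total n * total (Suc n))"
    by (simp add: power2_eq_square field_simps)
  also have "(total n + half_balance)\<^sup>2 = total n * total (Suc n) + half_balance\<^sup>2"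
    by (simp add: total_Suc power2_eq_square algebra_simps)
  finally show ?thesis
    by (simp add: add_divide_distrib)
qed

lemma growth_nonneg [simp]: "0 \<le> growth n"
  by (simp add: growth_def)

lemma growth_ge_1: "1 \<le> growth n"
  using growth_square[of n] by (intro power2_le_imp_le[of 1 "growth n"]) auto

lemma growth_le: "growth n - 1 \<le> half_balance\<^sup>2 / (total n)\<^sup>2"
proof -
  have "growth n \<le> (growth n)\<^sup>2"
    using growth_ge_1[of n] by (simp add: power2_eq_square mult_le_cancel_left1)
  also have "\<dots> - 1 \<le> half_balance\<^sup>2 / (total n)\<^sup>2"
    unfolding growth_square
    by (simp add: power2_eq_square[of "total n"] divide_left_mono mult_left_mono total_le_Suc)
  finally show ?thesis by simp
qed

lemma jump_square: "(jump n)\<^sup>2 = half_balance\<^sup>2 / total (Suc n)"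
  by (simp add: jump_def power_divide)

lemma jump_nonneg [simp]: "0 \<le> jump n"
  by (simp add: jump_def)

text \<open>The fraction \<open>q = c / half_balance\<close> is the fixed point of the mean drift:
  \<open>c + half_balance * q = 2 * half_balance * q\<close>. Hence the centred count is multiplied
  on average by \<open>1 + half_balance / total n\<close>, and changing the normalisation turns this
  into \<open>growth n\<close>.\<close>

lemma dev_Suc:
  assumes w: "w \<in> space M"
  shows "dev (Suc n) w = growth n * dev n w + jump n * (\<epsilon> (Suc n) w - red_prob n w)"
proof -
  have "sqrt (total (Suc n)) * (growth n * dev n w)
      = (1 + half_balance / total n) * (red n w - real c / half_balance * total n)"
    by (simp add: growth_def dev_def real_sqrt_divide)
  moreover have "sqrt (total (Suc n)) * (jump n * (\<epsilon> (Suc n) w - red_prob n w))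
      = half_balance * (\<epsilon> (Suc n) w - red_prob n w)"
    by (simp add: jump_def)
  moreover have "sqrt (total (Suc n)) * dev (Suc n) w = red (Suc n) w - real c / half_balance * total (Suc n)"
    by (simp add: dev_def)
  moreover have "red (Suc n) w - real c / half_balance * total (Suc n)
      = (1 + half_balance / total n) * (red n w - real c / half_balance * total n)
        + half_balance * (\<epsilon> (Suc n) w - red_prob n w)"
    by (simp add: red_Suc[OF w] total_Suc red_prob_def field_simps)
  ultimately have "sqrt (total (Suc n)) * dev (Suc n) w
      = sqrt (total (Suc n)) * (growth n * dev n w + jump n * (\<epsilon> (Suc n) w - red_prob n w))"
    by (simp only: distrib_left)
  then show ?thesis by (simp del: of_nat_Suc)
qed

lemma limit_fraction: "0 \<le> real c / half_balance" "real c / half_balance \<le> 1"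
  "1 - real c / half_balance = real b / half_balance"
  using half_balance_pos(1) by (auto simp: half_balance_def field_simps)

lemma red_prob_deviation: "red_prob n w - real c / half_balance = dev n w / sqrt (total n)"
proof -
  have "dev n w / sqrt (total n)
      = (red n w - real c / half_balance * total n) / (sqrt (total n) * sqrt (total n))"
    by (simp only: dev_def divide_divide_eq_left)
  then show ?thesis
    by (simp add: red_prob_def diff_divide_distrib)
qed

text \<open>A crude bound that grows with \<open>n\<close>; it serves integrability only.\<close>

lemma dev_bound:
  assumes w: "w \<in> space M"
  shows "\<bar>dev n w\<bar> \<le> sqrt (total n)"
proof -
  have "\<bar>dev n w / sqrt (total n)\<bar> \<le> 1"
    using red_prob_deviation[of n w] red_prob_bounds[OF w, of n] limit_fraction(1,2) by linarith
  then show ?thesis by (simp add: field_simps)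
qed

lemma integrable_dev [simp]: "integrable M (dev n)"
  by (intro integrable_const_bound[where B = "sqrt (total n)"] AE_I2) (auto simp: dev_bound)

lemma integrable_dev_square [simp]: "integrable M (\<lambda>w. (dev n w)\<^sup>2)"
proof (intro integrable_const_bound[where B = "total n"] AE_I2)
  fix w assume w: "w \<in> space M"
  show "norm ((dev n w)\<^sup>2) \<le> total n"
    using power_mono[OF dev_bound[OF w, of n], of 2] by simp
qed measurable

section \<open>Logarithmic growth of the second moment\<close>

definition second_moment :: "nat \<Rightarrow> real" where
  "second_moment n = expectation (\<lambda>w. (dev n w)\<^sup>2)"

lemma second_moment_nonneg: "0 \<le> second_moment n"
  by (simp add: second_moment_def)

text \<open>After expanding the square, the cross term has mean zero because \<open>dev n\<close> is
  known at time \<open>n\<close>, and the squared centred draw is bounded by 1.\<close>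

lemma second_moment_Suc:
  "second_moment (Suc n) \<le> (growth n)\<^sup>2 * second_moment n + (jump n)\<^sup>2"
proof -
  have bnd: "\<bar>\<epsilon> (Suc n) w\<bar> \<le> 1" "\<bar>red_prob n w\<bar> \<le> 1" "\<bar>\<epsilon> (Suc n) w - red_prob n w\<bar> \<le> 1"
    if "w \<in> space M" for w
    using draw_bounds[OF that, of "Suc n"] red_prob_bounds[OF that, of n] by auto
  have int: "integrable M (\<lambda>w. dev n w * \<epsilon> (Suc n) w)" "integrable M (\<lambda>w. dev n w * red_prob n w)"
    by (auto intro!: Bochner_Integration.integrable_bound[OF integrable_dev[of n]] AE_I2
        simp: abs_mult bnd mult_left_le)
  have "(dev (Suc n) w)\<^sup>2 \<le> (growth n)\<^sup>2 * (dev n w)\<^sup>2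
      + 2 * growth n * jump n * (dev n w * \<epsilon> (Suc n) w - dev n w * red_prob n w) + (jump n)\<^sup>2"
    if w: "w \<in> space M" for w
  proof -
    have "(\<epsilon> (Suc n) w - red_prob n w)\<^sup>2 \<le> 1"
      using bnd(3)[OF w] by (simp add: abs_square_le_1)
    then have "(jump n)\<^sup>2 * (\<epsilon> (Suc n) w - red_prob n w)\<^sup>2 \<le> (jump n)\<^sup>2"
      by (simp add: mult_left_le)
    then show ?thesis
      unfolding dev_Suc[OF w] by (simp add: power2_eq_square algebra_simps)
  qed
  then have "second_moment (Suc n) \<le> expectation (\<lambda>w. (growth n)\<^sup>2 * (dev n w)\<^sup>2
      + 2 * growth n * jump n * (dev n w * \<epsilon> (Suc n) w - dev n w * red_prob n w) + (jump n)\<^sup>2)"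
    unfolding second_moment_def 
    by (intro integral_mono Bochner_Integration.integrable_add Bochner_Integration.integrable_diff
        integrable_mult_right integrable_dev_square int) auto
  also have "\<dots> = (growth n)\<^sup>2 * second_moment n + (jump n)\<^sup>2"
    using expectation_draw_real[of "dev n" n]
    by (simp add: int prob_space second_moment_def)
  finally show ?thesis .
qed

lemma inverse_total_le_ln: "2 * half_balance / total (Suc n) \<le> ln (total (Suc n)) - ln (total n)"
proof -
  have "ln (total n / total (Suc n)) \<le> total n / total (Suc n) - 1"
    by (intro ln_le_minus_one) simp
  moreover have "total n / total (Suc n) - 1 = - (2 * half_balance / total (Suc n))"
    using total_pos(3)[of "Suc n"] unfolding total_Suc by (simp add: field_simps)
  ultimately show ?thesis by (simp add: ln_div)
qed

text \<open>The weight \<open>h\<close> is an integrating factor: it decreases just fast enough to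
  absorb \<open>(growth n)\<^sup>2\<close>, so \<open>h n * second_moment n\<close> increases only
  through the jumps, whose squares are dominated by increments of the logarithm. Since
  \<open>h\<close> stays between 1 and a constant, the bound carries over to
  \<open>second_moment\<close>.\<close>

lemma second_moment_bound:
  obtains A B where "0 \<le> A" "0 \<le> B" "\<And>n. second_moment n \<le> A + B * ln (total n)"
proof
  define h where "h n = exp (half_balance / (2 * total n))" for n
  define A where "A = h 0 * second_moment 0"
  define B where "B = exp (half_balance / 2) * (half_balance / 2)"
  show "0 \<le> A" by (simp add: A_def h_def second_moment_nonneg)
  show "0 \<le> B" by (simp add: B_def)
  have h1: "1 \<le> h n" for n by (simp add: h_def)
  have hle: "h n \<le> exp (half_balance / 2)" for n
    unfolding h_def exp_le_cancel_iff using total_ge_1[of n] by (intro divide_left_mono) auto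
  have h_growth: "h (Suc n) * (growth n)\<^sup>2 \<le> h n" for n
  proof -
    \<comment> \<open>Partial fractions, with
      \<open>total (Suc n) - total n = 2 * half_balance\<close>: the excess of
      \<open>(growth n)\<^sup>2\<close> over 1 telescopes.\<close>
    have "half_balance\<^sup>2 / (total n * total (Suc n))
        = half_balance / (2 * total n) - half_balance / (2 * total (Suc n))"
      using total_pos(3)[of "Suc n"] unfolding total_Suc
      by (simp add: divide_simps power2_eq_square) (simp add: algebra_simps)
    then have "(growth n)\<^sup>2 \<le> exp (half_balance / (2 * total n) - half_balance / (2 * total (Suc n)))"
      unfolding growth_square by (metis exp_ge_add_one_self)
    then have "(growth n)\<^sup>2 * h (Suc n)
        \<le> exp (half_balance / (2 * total n) - half_balance / (2 * total (Suc n))) * h (Suc n)"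
      by (intro mult_right_mono) (auto simp: h_def)
    then show ?thesis
      unfolding mult.commute[of "h (Suc n)"] by (simp only: h_def exp_add[symmetric] diff_add_cancel)
  qed
  have "h n * second_moment n \<le> A + B * (ln (total n) - ln (total 0))" for n
  proof (induction n)
    case (Suc n)
    have jump: "h (Suc n) * (jump n)\<^sup>2 \<le> B * (ln (total (Suc n)) - ln (total n))"
    proof -
      have "(jump n)\<^sup>2 = half_balance / 2 * (2 * half_balance / total (Suc n))"
        unfolding jump_square by (simp add: power2_eq_square)
      also have "\<dots> \<le> half_balance / 2 * (ln (total (Suc n)) - ln (total n))"
        by (intro mult_left_mono inverse_total_le_ln) simp
      finally have "h (Suc n) * (jump n)\<^sup>2
          \<le> exp (half_balance / 2) * (half_balance / 2 * (ln (total (Suc n)) - ln (total n)))"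
        by (intro mult_mono hle) auto
      then show ?thesis by (simp add: B_def mult_ac)
    qed
    have "h (Suc n) * second_moment (Suc n) \<le> h (Suc n) * ((growth n)\<^sup>2 * second_moment n + (jump n)\<^sup>2)"
      using h1[of "Suc n"] by (intro mult_left_mono second_moment_Suc) auto
    also have "\<dots> = (h (Suc n) * (growth n)\<^sup>2) * second_moment n + h (Suc n) * (jump n)\<^sup>2"
      by (simp add: algebra_simps)
    also have "\<dots> \<le> h n * second_moment n + B * (ln (total (Suc n)) - ln (total n))"
      by (intro add_mono mult_right_mono h_growth jump second_moment_nonneg)
    also have "\<dots> \<le> A + B * (ln (total (Suc n)) - ln (total 0))"
      using Suc by (simp add: algebra_simps)
    finally show ?case .
  qed (simp add: A_def)
  moreover have "second_moment n \<le> h n * second_moment n" for n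
    using h1[of n] second_moment_nonneg[of n] by (simp add: mult_le_cancel_right1)
  moreover have "B * (ln (total n) - ln (total 0)) \<le> B * ln (total n)" for n
    using total_ge_1[of 0] \<open>0 \<le> B\<close> by (intro mult_left_mono) auto
  ultimately show "second_moment n \<le> A + B * ln (total n)" for n
    by (smt (verit))
qed

section \<open>One-step and accumulated estimates of the characteristic function\<close>

definition dev_char :: "nat \<Rightarrow> real \<Rightarrow> complex" where
  "dev_char n \<theta> = (CLINT w|M. iexp (\<theta> * dev n w))"

text \<open>For a draw in {0, 1} any function of the draw is affine in it. The exponential is
  therefore \<open>h0 + (h1 - h0) * draw\<close>, where \<open>h1\<close> and \<open>h0\<close> are
  its values after a red and a white draw, and only the conditional mean of the draw is
  needed.\<close>

lemma dev_char_Suc_eq: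
  fixes \<theta> :: real
  defines "G \<equiv> \<lambda>n w. red_prob n w * iexp (\<theta> * jump n * (1 - red_prob n w))
      + (1 - red_prob n w) * iexp (- (\<theta> * jump n * red_prob n w))"
  shows "dev_char (Suc n) \<theta> = (CLINT w|M. iexp (\<theta> * growth n * dev n w) * G n w)"
proof -
  define h1 where "h1 w = iexp (\<theta> * growth n * dev n w + \<theta> * jump n * (1 - red_prob n w))" for w
  define h0 where "h0 w = iexp (\<theta> * growth n * dev n w - \<theta> * jump n * red_prob n w)" for w
  have [measurable]: "h1 \<in> borel_measurable (past M \<epsilon> n)" "h0 \<in> borel_measurable (past M \<epsilon> n)"
    unfolding h1_def h0_def by measurable
  then have meas: "h1 \<in> borel_measurable M" "h0 \<in> borel_measurable M"
    by (auto intro: past_measurable[of _ n])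
  have int: "integrable M h1" "integrable M h0"
    using meas by (auto intro!: integrable_const_bound[where B = 1] simp: h1_def h0_def simp del: of_real_add of_real_mult of_real_diff)
  let ?h = "\<lambda>w. h1 w - h0 w"
  have h: "integrable M ?h" using int by simp
  have int_h: "integrable M (\<lambda>w. ?h w * complex_of_real (g w))"
    if "g \<in> borel_measurable M" "\<And>w. w \<in> space M \<Longrightarrow> \<bar>g w\<bar> \<le> 1" for g
    using that meas by (intro Bochner_Integration.integrable_bound[OF h])
      (auto simp: norm_mult intro!: mult_left_le)
  have "\<bar>\<epsilon> (Suc n) w\<bar> \<le> 1" "\<bar>red_prob n w\<bar> \<le> 1" if "w \<in> space M" for w
    using draw_bounds[OF that, of "Suc n"] red_prob_bounds[OF that, of n] by auto
  then have int2: "integrable M (\<lambda>w. ?h w * \<epsilon> (Suc n) w)" "integrable M (\<lambda>w. ?h w * red_prob n w)"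
    by (auto intro!: int_h)
  have "dev_char (Suc n) \<theta> = (CLINT w|M. h0 w + ?h w * \<epsilon> (Suc n) w)"
    unfolding dev_char_def
  proof (intro Bochner_Integration.integral_cong refl)
    fix w assume w: "w \<in> space M"
    show "iexp (\<theta> * dev (Suc n) w) = h0 w + ?h w * \<epsilon> (Suc n) w"
      using draw_values[OF w, of "Suc n"] unfolding dev_Suc[OF w] h0_def h1_def
      by (auto simp: algebra_simps)
  qed
  also have "\<dots> = (CLINT w|M. h0 w + ?h w * red_prob n w)"
    using expectation_draw_complex[of ?h n] h by (simp add: int int2)
  also have "\<dots> = (CLINT w|M. iexp (\<theta> * growth n * dev n w) * G n w)"
    unfolding h0_def h1_def G_def
    by (intro Bochner_Integration.integral_cong refl) (simp add: algebra_simps exp_add exp_diff exp_minus divide_inverse)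
  finally show ?thesis .
qed

lemma jump_le: "jump n \<le> half_balance / sqrt (total n)"
  unfolding jump_def using total_le_Suc[of n] by (intro divide_left_mono) auto

text \<open>Each of the four errors of \<open>centered_bernoulli_step\<close> carries at least one
  factor \<bar>\<theta>\<bar>, and higher powers are reduced to it by \<bar>\<theta>\<bar> \<le> 1.
  This linear factor is what makes the accumulated error vanish after rescaling.\<close>

lemma dev_char_Suc_approx:
  assumes \<theta>: "\<bar>\<theta>\<bar> \<le> 1"
  shows "cmod (dev_char (Suc n) \<theta> - exp (- (\<theta>\<^sup>2 * (real b * real c) / (2 * total (Suc n)))) * dev_char n \<theta>)
    \<le> 4 * \<bar>\<theta>\<bar> * half_balance ^ 4 * ((1 + second_moment n) / (total n * sqrt (total n)))"
proof -
  define y where "y = \<theta>\<^sup>2 * (real b * real c) / (2 * total (Suc n))"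
  define s where "s = \<theta> * jump n"
  define q where "q = real c / half_balance"
  \<comment> \<open>A common bound for the four errors: the highest power of
    \<open>half_balance\<close> (which is at least 1) over the slowest decay, \<open>total n\<close>
    to the power 3/2.\<close>
  define \<kappa> where "\<kappa> = half_balance ^ 4 / (total n * sqrt (total n))"
  define G where "G w = red_prob n w * iexp (s * (1 - red_prob n w))
      + (1 - red_prob n w) * iexp (- (s * red_prob n w))" for w
  have q: "0 \<le> q" "q \<le> 1" "1 - q = real b / half_balance"
    unfolding q_def by (rule limit_fraction)+
  \<comment> \<open>The target exponent is the conditional variance term with
    \<open>red_prob\<close> replaced by its limit \<open>q\<close>.\<close>
  have y_eq: "y = s\<^sup>2 * (q * (1 - q)) / 2"
    unfolding q(3) unfolding y_def s_def q_def power_mult_distrib jump_square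
    by (simp add: field_simps power2_eq_square)
  have y0: "0 \<le> y" by (simp add: y_def)
  have sqrt_le: "sqrt (total n) \<le> total n"
    using total_ge_1[of n] by (intro real_le_lsqrt) (auto simp: power2_eq_square mult_le_cancel_left1)
  have hb_mono: "half_balance ^ i \<le> half_balance ^ 4" if "i \<le> 4" for i
    using half_balance_ge_1 that by (intro power_increasing)
  have \<kappa>_nonneg: "0 \<le> \<kappa>" by (simp add: \<kappa>_def)
  have le_\<kappa>: "half_balance ^ i / (total n * r) \<le> \<kappa>" if "i \<le> 4" "sqrt (total n) \<le> r" for i r
    unfolding \<kappa>_def using that hb_mono by (intro frac_le mult_left_mono) auto
  have \<theta>_pow: "\<bar>\<theta>\<bar> ^ i \<le> \<bar>\<theta>\<bar>" if "1 \<le> i" for i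
    using power_decreasing[OF that, of "\<bar>\<theta>\<bar>"] \<theta> by simp
  have sqrt_cube: "sqrt (total n) ^ 3 = total n * sqrt (total n)"
    by (simp add: eval_nat_numeral)
  have jump2: "(jump n)\<^sup>2 \<le> half_balance\<^sup>2 / total n"
    using power_mono[OF jump_le[of n], of 2] by (simp add: power_divide)
  have abs_s: "\<bar>s\<bar> ^ i = \<bar>\<theta>\<bar> ^ i * jump n ^ i" for i
    by (simp add: s_def abs_mult power_mult_distrib)
  have pointwise: "cmod (iexp (\<theta> * growth n * dev n w) * G w - exp (- y) * iexp (\<theta> * dev n w))
      \<le> 4 * \<bar>\<theta>\<bar> * \<kappa> * (1 + (dev n w)\<^sup>2)" if w: "w \<in> space M" for w
  proof -
    let ?z = "dev n w" and ?p = "red_prob n w"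
    \<comment> \<open>This lets the second moment control the terms that are linear in
      \<open>dev\<close>.\<close>
    have z: "\<bar>?z\<bar> \<le> 1 + ?z\<^sup>2"
    proof -
      have "0 \<le> (\<bar>?z\<bar> - 1)\<^sup>2" by simp
      then show ?thesis by (simp add: power2_diff)
    qed
    have t1: "\<bar>\<theta>\<bar> * \<bar>growth n - 1\<bar> * \<bar>?z\<bar> \<le> \<bar>\<theta>\<bar> * \<kappa> * (1 + ?z\<^sup>2)"
    proof (intro mult_mono z)
      have "half_balance\<^sup>2 / (total n)\<^sup>2 \<le> \<kappa>"
        using le_\<kappa>[of 2 "total n"] sqrt_le by (simp add: power2_eq_square)
      then show "\<bar>growth n - 1\<bar> \<le> \<kappa>"
        using growth_ge_1[of n] growth_le[of n] by simp
    qed (auto simp: \<kappa>_nonneg)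
    have t2: "\<bar>s\<bar> ^ 3 \<le> \<bar>\<theta>\<bar> * \<kappa>"
    proof -
      have "jump n ^ 3 \<le> (half_balance / sqrt (total n)) ^ 3"
        by (intro power_mono jump_le) simp
      also have "\<dots> \<le> \<kappa>"
        using le_\<kappa>[of 3 "sqrt (total n)"] by (simp add: power_divide sqrt_cube)
      finally show ?thesis
        unfolding abs_s by (intro mult_mono \<theta>_pow) auto
    qed
    have t3: "\<bar>s\<^sup>2 * (?p * (1 - ?p)) / 2 - y\<bar> \<le> \<bar>\<theta>\<bar> * \<kappa> * (1 + ?z\<^sup>2)"
    proof -
      \<comment> \<open>The identity p(1-p) - q(1-q) = (p-q)(1-p-q) makes the variance error
        proportional to \<open>red_prob n w - q\<close>, which is
        \<open>dev n w / sqrt (total n)\<close>.\<close>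
      have "s\<^sup>2 * (?p * (1 - ?p)) / 2 - y = s\<^sup>2 / 2 * ((?p - q) * (1 - ?p - q))"
        unfolding y_eq by (simp add: field_simps)
      also have "\<bar>\<dots>\<bar> = s\<^sup>2 / 2 * (\<bar>?p - q\<bar> * \<bar>1 - ?p - q\<bar>)"
        by (simp add: abs_mult)
      also have "\<dots> \<le> s\<^sup>2 * (\<bar>?p - q\<bar> * 1)"
        using q red_prob_bounds[OF w, of n] by (intro mult_mono) auto
      also have "\<dots> = \<bar>\<theta>\<bar>\<^sup>2 * (jump n)\<^sup>2 * (\<bar>?z\<bar> / sqrt (total n))"
        unfolding q_def red_prob_deviation by (simp add: s_def power_mult_distrib abs_divide)
      also have "\<dots> \<le> \<bar>\<theta>\<bar> * (half_balance\<^sup>2 / total n) * (\<bar>?z\<bar> / sqrt (total n))"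
        by (intro mult_mono \<theta>_pow jump2) auto
      also have "\<dots> = \<bar>\<theta>\<bar> * (half_balance\<^sup>2 / (total n * sqrt (total n))) * \<bar>?z\<bar>"
        by simp
      also have "\<dots> \<le> \<bar>\<theta>\<bar> * \<kappa> * (1 + ?z\<^sup>2)"
        using le_\<kappa>[of 2 "sqrt (total n)"] by (intro mult_mono z) (auto simp: \<kappa>_nonneg)
      finally show ?thesis .
    qed
    have t4: "y\<^sup>2 \<le> \<bar>\<theta>\<bar> * \<kappa>"
    proof -
      have "q * (1 - q) \<le> 1" using q(1,2) by (intro mult_le_one) auto
      then have "s\<^sup>2 * (q * (1 - q)) \<le> s\<^sup>2" by (intro mult_left_le) auto
      then have "y \<le> s\<^sup>2" unfolding y_eq using zero_le_power2[of s] by linarith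
      then have "y\<^sup>2 \<le> (s\<^sup>2)\<^sup>2" using y0 by (intro power_mono)
      also have "\<dots> = \<bar>\<theta>\<bar> ^ 4 * ((jump n)\<^sup>2)\<^sup>2"
        by (simp add: s_def power_mult_distrib flip: power_mult)
      also have "\<dots> \<le> \<bar>\<theta>\<bar> * (half_balance\<^sup>2 / total n)\<^sup>2"
        by (intro mult_mono \<theta>_pow power_mono jump2) auto
      also have "(half_balance\<^sup>2 / total n)\<^sup>2 = half_balance ^ 4 / (total n * total n)"
        by (simp add: power_divide power2_eq_square[of "total n"] flip: power_mult)
      also have "\<bar>\<theta>\<bar> * \<dots> \<le> \<bar>\<theta>\<bar> * \<kappa>"
        using sqrt_le by (intro mult_left_mono le_\<kappa>) auto
      finally show ?thesis .
    qed
    let ?E = "\<bar>\<theta>\<bar> * \<kappa> * (1 + ?z\<^sup>2)"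
    have E: "\<bar>\<theta>\<bar> * \<kappa> \<le> ?E"
      using \<kappa>_nonneg by (simp add: algebra_simps)
    have "cmod (iexp (\<theta> * growth n * dev n w) * G w - exp (- y) * iexp (\<theta> * dev n w))
        \<le> \<bar>\<theta>\<bar> * \<bar>growth n - 1\<bar> * \<bar>?z\<bar> + \<bar>s\<bar> ^ 3 + \<bar>s\<^sup>2 * (?p * (1 - ?p)) / 2 - y\<bar> + y\<^sup>2"
      unfolding G_def by (rule centered_bernoulli_step[OF red_prob_bounds[OF w] y0])
    also have "\<dots> \<le> ?E + ?E + ?E + ?E"
      by (intro add_mono t1 t3 order.trans[OF t2 E] order.trans[OF t4 E])
    also have "\<dots> = 4 * \<bar>\<theta>\<bar> * \<kappa> * (1 + ?z\<^sup>2)"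
      by simp
    finally show ?thesis .
  qed
  have int: "integrable M (\<lambda>w. iexp (\<theta> * growth n * dev n w) * G w)" "integrable M (\<lambda>w. iexp (\<theta> * dev n w))"
  proof -
    have "cmod (G w) \<le> 2" if "w \<in> space M" for w
    proof -
      have "cmod (G w) \<le> cmod (red_prob n w * iexp (s * (1 - red_prob n w)))
          + cmod ((1 - red_prob n w) * iexp (- (s * red_prob n w)))"
        unfolding G_def by (rule norm_triangle_ineq)
      also have "\<dots> = red_prob n w + (1 - red_prob n w)"
        using red_prob_bounds[OF that, of n] norm_of_real[of "1 - red_prob n w", where 'a = complex]
        by (simp add: norm_mult del: of_real_mult of_real_minus)
      finally show ?thesis by simp
    qed
    then have "norm (iexp (\<theta> * growth n * dev n w) * G w) \<le> 2" if "w \<in> space M" for w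
      unfolding norm_mult norm_exp_i_times using that by simp
    moreover have "(\<lambda>w. iexp (\<theta> * growth n * dev n w) * G w) \<in> borel_measurable M"
      unfolding G_def by measurable
    ultimately show "integrable M (\<lambda>w. iexp (\<theta> * growth n * dev n w) * G w)"
      by (intro integrable_const_bound[where B = 2] AE_I2)
    show "integrable M (\<lambda>w. iexp (\<theta> * dev n w))"
      by (intro integrable_const_bound[where B = 1] AE_I2) (simp_all del: of_real_mult)
  qed
  have diff_eq: "dev_char (Suc n) \<theta> - exp (- y) * dev_char n \<theta>
      = (CLINT w|M. iexp (\<theta> * growth n * dev n w) * G w - exp (- y) * iexp (\<theta> * dev n w))"
  proof -
    have "dev_char (Suc n) \<theta> = (CLINT w|M. iexp (\<theta> * growth n * dev n w) * G w)"
      unfolding G_def s_def by (rule dev_char_Suc_eq)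
    moreover have "(CLINT w|M. exp (- y) * iexp (\<theta> * dev n w)) = exp (- y) * dev_char n \<theta>"
      unfolding dev_char_def by (rule integral_mult_right_zero)
    ultimately show ?thesis
      unfolding Bochner_Integration.integral_diff[OF int(1) integrable_mult_right[OF int(2)]]
      by (rule arg_cong2[where f = "(-)", OF _ sym])
  qed
  have "cmod (dev_char (Suc n) \<theta> - exp (- y) * dev_char n \<theta>)
      \<le> expectation (\<lambda>w. cmod (iexp (\<theta> * growth n * dev n w) * G w - exp (- y) * iexp (\<theta> * dev n w)))"
    unfolding diff_eq by (rule integral_norm_bound)
  also have "\<dots> \<le> expectation (\<lambda>w. 4 * \<bar>\<theta>\<bar> * \<kappa> * (1 + (dev n w)\<^sup>2))"
  proof (rule integral_mono)
    show "integrable M (\<lambda>w. cmod (iexp (\<theta> * growth n * dev n w) * G w - exp (- y) * iexp (\<theta> * dev n w)))"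
      by (intro integrable_norm Bochner_Integration.integrable_diff[OF int(1) integrable_mult_right[OF int(2)]])
    show "integrable M (\<lambda>w. 4 * \<bar>\<theta>\<bar> * \<kappa> * (1 + (dev n w)\<^sup>2))"
      by (intro integrable_mult_right Bochner_Integration.integrable_add integrable_dev_square) simp
  qed (rule pointwise)
  also have "\<dots> = 4 * \<bar>\<theta>\<bar> * half_balance ^ 4 * ((1 + second_moment n) / (total n * sqrt (total n)))"
  proof -
    have "expectation (\<lambda>w. 1 + (dev n w)\<^sup>2) = 1 + second_moment n"
      by (simp add: second_moment_def prob_space)
    then show ?thesis
      unfolding integral_mult_right_zero by (simp add: \<kappa>_def)
  qed
  finally show ?thesis
    unfolding y_def .
qed

text \<open>The logarithmic bound on the second moment keeps the one-step errors summable, so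
  \<open>K\<close> depends on neither \<open>n\<close> nor \<open>\<theta>\<close>.\<close>

lemma dev_char_approx:
  obtains K where "\<And>n \<theta>. \<bar>\<theta>\<bar> \<le> 1 \<Longrightarrow>
    cmod (dev_char n \<theta> - exp (- (\<theta>\<^sup>2 * (real b * real c) / 2 * (\<Sum>k<n. 1 / total (Suc k)))) * dev_char 0 \<theta>)
      \<le> K * \<bar>\<theta>\<bar>"
proof -
  define r where "r k = (1 + second_moment k) / (total k * sqrt (total k))" for k
  have r_nonneg: "0 \<le> r k" for k
    by (simp add: r_def second_moment_nonneg)
  obtain A B where AB: "\<And>n. second_moment n \<le> A + B * ln (total n)"
    using second_moment_bound by metis
  have "summable (\<lambda>k. ((1 + A) + B * ln (total k)) / (total k * sqrt (total k)))"
    unfolding total_def using initial_nonempty by (intro summable_ln_div_linear) auto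
  then have summable: "summable r"
  proof (rule summable_comparison_test'[where N = 0])
    have "r k \<le> ((1 + A) + B * ln (total k)) / (total k * sqrt (total k))" for k
      unfolding r_def using AB[of k] by (intro divide_right_mono) auto
    then show "norm (r k) \<le> ((1 + A) + B * ln (total k)) / (total k * sqrt (total k))" for k
      using r_nonneg[of k] by simp
  qed
  show ?thesis
  proof
    fix n \<theta> assume \<theta>: "\<bar>\<theta>\<bar> \<le> (1::real)"
    let ?y = "\<lambda>k. \<theta>\<^sup>2 * (real b * real c) / (2 * total (Suc k))"
    have sum_y: "(\<Sum>k<n. ?y k) = \<theta>\<^sup>2 * (real b * real c) / 2 * (\<Sum>k<n. 1 / total (Suc k))"
      by (simp add: sum_distrib_left)
    have "cmod (dev_char n \<theta> - exp (- (\<Sum>k<n. ?y k)) * dev_char 0 \<theta>)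
        \<le> (\<Sum>k<n. 4 * \<bar>\<theta>\<bar> * half_balance ^ 4 * r k)"
    proof (rule approximate_product)
      show "cmod (dev_char (Suc k) \<theta> - exp (- ?y k) * dev_char k \<theta>) \<le> 4 * \<bar>\<theta>\<bar> * half_balance ^ 4 * r k" for k
        unfolding r_def by (rule dev_char_Suc_approx[OF \<theta>])
    qed simp
    also have "\<dots> \<le> 4 * \<bar>\<theta>\<bar> * half_balance ^ 4 * suminf r"
      unfolding sum_distrib_left[symmetric]
      by (intro mult_left_mono sum_le_suminf summable) (auto simp: r_nonneg)
    finally show "cmod (dev_char n \<theta> - exp (- (\<theta>\<^sup>2 * (real b * real c) / 2 * (\<Sum>k<n. 1 / total (Suc k)))) * dev_char 0 \<theta>)
        \<le> (4 * half_balance ^ 4 * suminf r) * \<bar>\<theta>\<bar>"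
      unfolding sum_y by (simp only: mult_ac)
  qed
qed

section \<open>The harmonic sum and the passage to the limit\<close>

lemma inverse_total_ge_ln: "ln (total (Suc n)) - ln (total n) \<le> 2 * half_balance / total n"
proof -
  have "ln (total (Suc n) / total n) \<le> total (Suc n) / total n - 1"
    by (intro ln_le_minus_one) simp
  also have "\<dots> = 2 * half_balance / total n"
    by (simp add: total_Suc field_simps)
  finally show ?thesis by (simp add: ln_div)
qed

lemma sum_inverse_total_asymp:
  "(\<lambda>n. (\<Sum>k<n. 1 / total (Suc k)) / ln (real n)) \<longlonglongrightarrow> 1 / (2 * half_balance)"
proof (rule tendsto_sandwich)
  let ?t = "real (\<alpha> + \<beta>)"
  \<comment> \<open>The term \<open>1 / total (Suc k)\<close> is compared with the logarithmic
    increment after \<open>Suc k\<close> for the lower bound, and with the one ending at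
    \<open>Suc k\<close> for the upper bound; both sums telescope.\<close>
  have lower: "ln (total (Suc n)) - ln (total 1) \<le> 2 * half_balance * (\<Sum>k<n. 1 / total (Suc k))" for n
    unfolding sum_distrib_left
    using sum_mono[of "{..<n}" "\<lambda>k. ln (total (Suc (Suc k))) - ln (total (Suc k))" "\<lambda>k. 2 * half_balance * (1 / total (Suc k))"]
      inverse_total_ge_ln
    by (simp add: sum_lessThan_telescope[of "\<lambda>k. ln (total (Suc k))"])
  have upper: "2 * half_balance * (\<Sum>k<n. 1 / total (Suc k)) \<le> ln (total n) - ln (total 0)" for n
    unfolding sum_distrib_left
    using sum_mono[of "{..<n}" "\<lambda>k. 2 * half_balance * (1 / total (Suc k))" "\<lambda>k. ln (total (Suc k)) - ln (total k)"]
      inverse_total_le_ln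
    by (simp add: sum_lessThan_telescope[of "\<lambda>k. ln (total k)"])
  show "\<forall>\<^sub>F n in sequentially. (ln (total (Suc n)) - ln (total 1)) / (2 * half_balance) / ln (real n)
      \<le> (\<Sum>k<n. 1 / total (Suc k)) / ln (real n)"
    using eventually_ge_at_top[of 2]
    by eventually_elim (intro divide_right_mono, use lower in \<open>simp add: field_simps\<close>, simp)
  show "\<forall>\<^sub>F n in sequentially. (\<Sum>k<n. 1 / total (Suc k)) / ln (real n)
      \<le> (ln (total n) - ln (total 0)) / (2 * half_balance) / ln (real n)"
    using eventually_ge_at_top[of 2]
    by eventually_elim (intro divide_right_mono, use upper in \<open>simp add: field_simps\<close>, simp)
  have *: "(\<lambda>n. (ln (t + real n * m) - x) / m / ln (real n)) \<longlonglongrightarrow> inverse m" if "0 < m" for t m x :: real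
    using that by real_asymp
  show "(\<lambda>n. (ln (total n) - ln (total 0)) / (2 * half_balance) / ln (real n)) \<longlonglongrightarrow> 1 / (2 * half_balance)"
    unfolding total_def inverse_eq_divide[symmetric] by (rule *) simp
  have total_shift: "total (Suc n) = (?t + 2 * half_balance) + real n * (2 * half_balance)" for n
    by (simp add: total_def algebra_simps)
  have "(\<lambda>n. (ln ((?t + 2 * half_balance) + real n * (2 * half_balance)) - ln (total 1)) / (2 * half_balance) / ln (real n))
      \<longlonglongrightarrow> inverse (2 * half_balance)"
    by (rule *) simp
  then show "(\<lambda>n. (ln (total (Suc n)) - ln (total 1)) / (2 * half_balance) / ln (real n)) \<longlonglongrightarrow> 1 / (2 * half_balance)"
    by (simp only: total_shift inverse_eq_divide)
qed

text \<open>This is the centred red count over \<open>sqrt (n * ln n)\<close>, written as a multiple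
  of \<open>dev\<close> so that its characteristic function is \<open>dev_char\<close> at a rescaled
  argument.\<close>

definition scaled_dev :: "nat \<Rightarrow> 'a \<Rightarrow> real" where
  "scaled_dev n w = dev n w * sqrt (total n / (real n * ln (real n)))"

lemma scaled_dev_measurable [measurable]: "scaled_dev n \<in> borel_measurable M"
  unfolding scaled_dev_def by measurable

text \<open>The argument \<open>\<theta> n\<close> tends to 0, which removes both the error
  \<open>K * \<bar>\<theta> n\<bar>\<close> and the influence of the initial composition. The
  exponent \<open>e n\<close> survives: \<open>total n / n\<close> tends to
  \<open>2 * half_balance\<close>, which cancels the constant of the harmonic sum.\<close>

lemma char_scaled_dev_tendsto:
  "(\<lambda>n. char (distr M borel (scaled_dev n)) t) \<longlonglongrightarrow> complex_of_real (exp (- (t\<^sup>2 * (real b * real c) / 2)))"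
proof -
  define \<theta> where "\<theta> n = t * sqrt (total n / (real n * ln (real n)))" for n
  define e where "e n = (\<theta> n)\<^sup>2 * (real b * real c) / 2 * (\<Sum>k<n. 1 / total (Suc k))" for n
  have char: "char (distr M borel (scaled_dev n)) t = dev_char n (\<theta> n)" for n
    by (simp add: char_def integral_distr dev_char_def scaled_dev_def \<theta>_def mult_ac)
  have "(\<lambda>n. (a + real n * m) / (real n * ln (real n))) \<longlonglongrightarrow> 0" if "0 < m" for a m :: real
    using that by real_asymp
  from this[of "2 * half_balance" "real (\<alpha> + \<beta>)"]
  have ratio: "(\<lambda>n. total n / (real n * ln (real n))) \<longlonglongrightarrow> 0"
    by (simp add: total_def)
  have \<theta>_lim: "\<theta> \<longlonglongrightarrow> 0"
    unfolding \<theta>_def using tendsto_mult_right_zero[OF tendsto_real_sqrt[OF ratio, simplified]] .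
  have "(\<lambda>n. (a + real n * m) / real n) \<longlonglongrightarrow> m" if "0 < m" for a m :: real
    using that by real_asymp
  from this[of "2 * half_balance" "real (\<alpha> + \<beta>)"]
  have linear: "(\<lambda>n. total n / real n) \<longlonglongrightarrow> 2 * half_balance"
    by (simp add: total_def)
  have "(\<lambda>n. t\<^sup>2 * (real b * real c) / 2 * (total n / real n * ((\<Sum>k<n. 1 / total (Suc k)) / ln (real n))))
      \<longlonglongrightarrow> t\<^sup>2 * (real b * real c) / 2 * (2 * half_balance * (1 / (2 * half_balance)))"
    by (intro tendsto_mult tendsto_const linear sum_inverse_total_asymp)
  moreover have "\<forall>\<^sub>F n in sequentially. e n = t\<^sup>2 * (real b * real c) / 2 * (total n / real n * ((\<Sum>k<n. 1 / total (Suc k)) / ln (real n)))"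
    using eventually_ge_at_top[of 1]
    by eventually_elim (simp add: e_def \<theta>_def power_mult_distrib mult_ac)
  ultimately have e_lim: "e \<longlonglongrightarrow> t\<^sup>2 * (real b * real c) / 2"
    by (simp add: tendsto_cong)
  \<comment> \<open>The initial deviation is deterministic, so its characteristic function is
    explicit and tends to 1 as the argument tends to 0.\<close>
  have dev0: "dev 0 w = (real \<alpha> - real c / half_balance * total 0) / sqrt (total 0)" if "w \<in> space M" for w
    by (simp add: dev_def red_0 that)
  have char0: "dev_char 0 x = iexp (x * ((real \<alpha> - real c / half_balance * total 0) / sqrt (total 0)))" for x
  proof -
    have "dev_char 0 x = (CLINT w|M. iexp (x * ((real \<alpha> - real c / half_balance * total 0) / sqrt (total 0))))"
      unfolding dev_char_def by (intro Bochner_Integration.integral_cong) (auto simp: dev0)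
    then show ?thesis by (simp add: prob_space)
  qed
  have "(\<lambda>n. dev_char 0 (\<theta> n)) \<longlonglongrightarrow> iexp (0 * ((real \<alpha> - real c / half_balance * total 0) / sqrt (total 0)))"
    unfolding char0 by (intro tendsto_intros \<theta>_lim)
  moreover have "(\<lambda>n. complex_of_real (exp (- e n))) \<longlonglongrightarrow> complex_of_real (exp (- (t\<^sup>2 * (real b * real c) / 2)))"
    by (intro tendsto_intros e_lim)
  ultimately have main: "(\<lambda>n. exp (- e n) * dev_char 0 (\<theta> n)) \<longlonglongrightarrow> complex_of_real (exp (- (t\<^sup>2 * (real b * real c) / 2)))"
    by (force dest: tendsto_mult)
  obtain K where K: "\<And>n \<theta>. \<bar>\<theta>\<bar> \<le> 1 \<Longrightarrow>
    cmod (dev_char n \<theta> - exp (- (\<theta>\<^sup>2 * (real b * real c) / 2 * (\<Sum>k<n. 1 / total (Suc k)))) * dev_char 0 \<theta>) \<le> K * \<bar>\<theta>\<bar>"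
    using dev_char_approx by blast
  have "\<forall>\<^sub>F n in sequentially. \<bar>\<theta> n\<bar> < 1"
    using tendsto_rabs[OF \<theta>_lim] by (intro order_tendstoD(2)) auto
  then have "\<forall>\<^sub>F n in sequentially. cmod (dev_char n (\<theta> n) - exp (- e n) * dev_char 0 (\<theta> n)) \<le> K * \<bar>\<theta> n\<bar>"
    by eventually_elim (use K in \<open>simp add: e_def\<close>)
  moreover have "(\<lambda>n. K * \<bar>\<theta> n\<bar>) \<longlonglongrightarrow> 0"
    using tendsto_mult_right_zero[OF tendsto_rabs[OF \<theta>_lim, simplified]] by simp
  ultimately have "(\<lambda>n. dev_char n (\<theta> n) - exp (- e n) * dev_char 0 (\<theta> n)) \<longlonglongrightarrow> 0"
    by (rule Lim_null_comparison)
  from tendsto_add[OF this main] show ?thesis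
    by (simp add: char)
qed

text \<open>The centring \<open>n * v\<close> and the exact centring by \<open>total n\<close>
  differ by a vector that is constant in \<open>n\<close>. The identity also holds for
  \<open>n = 0\<close> and \<open>n = 1\<close>, where the normalisation is 0 and both sides are 0
  by convention.\<close>

lemma composition_eq:
  fixes v :: "real ^ 2"
  assumes v: "v = (2 * half_balance / half_balance) *\<^sub>R vector [real c, real b]" and w: "w \<in> space M"
  defines "x \<equiv> real c / half_balance * total 0"
  shows "(U n w - real n *\<^sub>R v) /\<^sub>R sqrt (real n * ln (real n))
    = vector [scaled_dev n w, - scaled_dev n w] + vector [x, total 0 - x] /\<^sub>R sqrt (real n * ln (real n))"
proof -
  define D where "D = red n w - real c / half_balance * total n"
  have tot: "total n = total 0 + 2 * (real b + real c) * real n"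
    by (simp add: total_def half_balance_def)
  have "real c / half_balance * total n = x + 2 * real c * real n"
    unfolding x_def tot by (simp add: half_balance_def[symmetric] field_simps)
  then have red: "red n w = D + x + 2 * real c * real n"
    by (simp add: D_def)
  have "U n w - real n *\<^sub>R v = vector [D, - D] + vector [x, total 0 - x]"
    using white_eq[OF w, of n] red tot
    by (simp add: vec_eq_iff forall_2 v red_def[symmetric] algebra_simps)
  moreover have "scaled_dev n w = inverse (sqrt (real n * ln (real n))) * D"
    unfolding scaled_dev_def dev_def D_def[symmetric] real_sqrt_divide by (simp add: field_simps)
  then have "vector [scaled_dev n w, - scaled_dev n w] = (vector [D, - D] :: real ^ 2) /\<^sub>R sqrt (real n * ln (real n))"
    by (simp add: vec_eq_iff forall_2)
  ultimately show ?thesis by (simp add: scaleR_add_right)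
qed

end

section \<open>From the scalar limit law to the composition vector\<close>

theorem theorem3p9:
  fixes M :: "'w measure"
    and a b c d \<alpha> \<beta> :: nat
    and \<epsilon> :: "nat \<Rightarrow> 'w \<Rightarrow> real"
    and U :: "nat \<Rightarrow> 'w \<Rightarrow> real ^ 2"
    and S m \<sigma> :: real
    and v\<^sub>1 :: "real ^ 2"
    and \<Gamma> :: "real ^ 2 ^ 2"
  assumes urn: "balanced_polya_urn M a b c d \<alpha> \<beta> \<epsilon> U"
    and S: "S = real a + real b"
    and m: "m = real a - real c"
    and sigma: "\<sigma> = m / S"
    and v1: "v\<^sub>1 = (S / (real b + real c)) *\<^sub>R vector [real c, real b]"
    and Gamma: "\<Gamma> = (real b * real c) *\<^sub>R vector [vector [1, - 1], vector [- 1, 1]]"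
    and critically_small: "\<sigma> = 1 / 2"
    and bc: "b * c \<noteq> 0"
  shows "converges_in_distribution M
           (\<lambda>n w. (U n w - real n *\<^sub>R v\<^sub>1) /\<^sub>R sqrt (real n * ln (real n)))
           (gaussian 0 \<Gamma>)"
proof -
  interpret balanced_polya_urn M a b c d \<alpha> \<beta> \<epsilon> U by (rule urn)
  have "m / S = 1 / 2" "0 < S"
    using critically_small sigma balance_pos S by auto
  then have "real a = real b + 2 * real c"
    unfolding m S by (simp add: field_simps)
  then interpret critical_polya_urn M a b c d \<alpha> \<beta> \<epsilon> U
    by unfold_locales linarith
  have v1': "v\<^sub>1 = (2 * half_balance / half_balance) *\<^sub>R vector [real c, real b]"
    unfolding v1 using S balance_eq by (simp add: half_balance_def)
  obtain r :: "real ^ 2" where r: "(norm r)\<^sup>2 = real b * real c"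
    and gauss: "gaussian 0 \<Gamma> = distr (distr standard_gaussian borel (\<lambda>z. r \<bullet> z)) borel (\<lambda>x. vector [x, - x])"
    unfolding Gamma by (rule gaussian_antidiagonal[of "real b * real c"]) auto
  let ?\<nu> = "distr standard_gaussian borel (\<lambda>z. r \<bullet> z)"
  have \<nu>: "real_distribution ?\<nu>"
    by (intro prob_space.real_distribution_distr prob_space_standard_gaussian) simp
  \<comment> \<open>By Levy's continuity theorem, the limits of the characteristic functions
    suffice; \<open>r\<close> was obtained with squared norm \<open>b * c\<close> so that they
    match.\<close>
  have weak: "weak_conv_m (\<lambda>n. distr M borel (scaled_dev n)) ?\<nu>"
  proof (rule levy_continuity[OF _ \<nu>])
    show "(\<lambda>n. char (distr M borel (scaled_dev n)) t) \<longlonglongrightarrow> char ?\<nu> t" for t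
      unfolding char_inner_standard_gaussian r using char_scaled_dev_tendsto[of t] by simp
  qed simp
  define x where "x = real c / half_balance * total 0"
  define shift :: "nat \<Rightarrow> real ^ 2" where
    "shift n = vector [x, total 0 - x] /\<^sub>R sqrt (real n * ln (real n))" for n
  have "(\<lambda>n. inverse (sqrt (real n * ln (real n)))) \<longlonglongrightarrow> 0"
    by real_asymp
  then have shift: "shift \<longlonglongrightarrow> 0"
    unfolding shift_def using tendsto_scaleR[OF _ tendsto_const] by fastforce
  define Z where "Z n w = (U n w - real n *\<^sub>R v\<^sub>1) /\<^sub>R sqrt (real n * ln (real n))" for n w
  have Z: "Z n w = vector [scaled_dev n w, - scaled_dev n w] + shift n" if "w \<in> space M" for n w
    unfolding Z_def shift_def x_def by (rule composition_eq[OF v1' that])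
  have Z_meas [measurable]: "Z n \<in> borel_measurable M" for n
  proof -
    have "(\<lambda>w. vector [scaled_dev n w, - scaled_dev n w] + shift n) \<in> borel_measurable M"
      by measurable
    then show ?thesis by (simp add: Z cong: measurable_cong)
  qed
  have "(\<lambda>n. integral\<^sup>L (distr M borel (Z n)) f) \<longlonglongrightarrow> integral\<^sup>L (gaussian 0 \<Gamma>) f"
    if f: "continuous_on UNIV f" "bounded (range f)" for f :: "real ^ 2 \<Rightarrow> real"
  proof -
    have [measurable]: "f \<in> borel_measurable borel"
      using f(1) by (rule borel_measurable_continuous_onI)
    have "integral\<^sup>L (distr M borel (Z n)) f
        = (LINT x|distr M borel (scaled_dev n). f (vector [x, - x] + shift n))" for n
      by (simp add: integral_distr Z cong: Bochner_Integration.integral_cong)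
    moreover have "integral\<^sup>L (gaussian 0 \<Gamma>) f = (LINT x|?\<nu>. f (vector [x, - x]))"
      unfolding gauss by (rule integral_distr) measurable
    moreover have "(\<lambda>n. LINT x|distr M borel (scaled_dev n). f (vector [x, - x] + shift n))
        \<longlonglongrightarrow> (LINT x|?\<nu>. f (vector [x, - x]))"
      by (rule weak_conv_antidiagonal_shift[OF _ \<nu> weak f shift]) simp
    ultimately show ?thesis by simp
  qed
  then show ?thesis
    unfolding converges_in_distribution_def Z_def by blast
qed

end
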